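(* Let $N$ be a $\mathbb{Z}_{+}$-valued random variable with probability mass function $\mathbb{P}(N=n)=p_n=Q^{(n)}(0)/n!$, $n\in\mathbb{Z}_+$, and probability generating function $Q(w)=\sum_{n\ge0}p_nw^n$ such that $$Q(w)=\varphi(1-w)=\int_0^\infty e^{-(1-w)x}f(x)\,dx ,$$ where $\varphi(s)=\int_0^\infty e^{-sx}f(x)\,dx$ is the Laplace transform of a positive random variable $X$ with probability density $f(x)=dF_X(x)/dx$, $F_X(x)=\mathbb{P}(X<x)$. Then, for all $n\in\mathbb{Z}_+$, $p_n$ satisfies the one-step recurrence relation $$p_{n+1}=\frac{p_n}{n+1}\,g(n),\qquad g(n)=\frac{Q^{(n+1)}(0)}{Q^{(n)}(0)}=\frac{(n+1)p_{n+1}}{p_n}=\frac{\int_0^\infty e^{-x}x^{n+1}f(x)\,dx}{\int_0^\infty e^{-x}x^{n}f(x)\,dx}.$$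
   Context: $\mathbb{Z}_+=\{0,1,2,\ldots\}$; $Q^{(n)}$ denotes the $n$-th derivative of $Q$. The representation of $Q$ holds for $w\in[0,1]$. *)

theory Defs
  imports "HOL-Probability.Probability"
begin

definition prob_mass :: "'a measure \<Rightarrow> ('a \<Rightarrow> nat) \<Rightarrow> nat \<Rightarrow> real" where
  "prob_mass M N n = \<P>(\<omega> in M. N \<omega> = n)"

text \<open>
  The series converges for \<open>\<bar>w\<bar> \<le> 1\<close>, so derivatives at \<open>0\<close> of the real function below
  are ordinary two-sided derivatives of a power series; values outside \<open>[-1, 1]\<close> are irrelevant.
\<close>
definition prob_gen_fun :: "'a measure \<Rightarrow> ('a \<Rightarrow> nat) \<Rightarrow> real \<Rightarrow> real" where
  "prob_gen_fun M N w = (\<Sum>n. prob_mass M N n * w ^ n)"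

definition laplace_transform :: "(real \<Rightarrow> real) \<Rightarrow> real \<Rightarrow> real" where
  "laplace_transform f s = (LBINT x:{0..}. exp (- s * x) * f x)"

definition nth_deriv_at_0 :: "(real \<Rightarrow> real) \<Rightarrow> nat \<Rightarrow> real" where
  "nth_deriv_at_0 Q n = (deriv ^^ n) Q 0"

definition recurrence_ratio :: "(real \<Rightarrow> real) \<Rightarrow> nat \<Rightarrow> real" where
  "recurrence_ratio Q n = nth_deriv_at_0 Q (n + 1) / nth_deriv_at_0 Q n"

end

theory Submission
  imports Defs "HOL-Complex_Analysis.Cauchy_Integral_Formula"
begin

text \<open>
  Write \<open>m\<^sub>n\<close> for the exponentially damped moment \<open>\<integral>\<^sub>0\<^sup>\<infinity> e\<^sup>-\<^sup>x x\<^sup>n f(x) dx\<close>. Everything follows from the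
  mixed Poisson formula \<open>p\<^sub>n = m\<^sub>n / n!\<close>: the probability \<open>p\<^sub>n\<close> is the average over \<open>X\<close> of the Poisson
  weight \<open>e\<^sup>-\<^sup>X X\<^sup>n / n!\<close>. To obtain it, expand \<open>e\<^sup>-\<^sup>(\<^sup>1\<^sup>-\<^sup>w\<^sup>)\<^sup>x = e\<^sup>-\<^sup>x e\<^sup>w\<^sup>x\<close> in powers of \<open>w\<close>. For
  \<open>0 \<le> w \<le> 1\<close> the partial sums of the damped exponential series stay below \<open>1\<close>, so \<open>f\<close> itself
  dominates and the Laplace integral may be taken term by term
  (\<open>damped_moments_sums_laplace_transform\<close>). On \<open>[0, 1]\<close> both \<open>\<Sum> p\<^sub>n w\<^sup>n\<close> and \<open>\<Sum> (m\<^sub>n / n!) w\<^sup>n\<close> then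
  represent \<open>\<phi>(1 - w)\<close>, and a power series is determined by its values on a one-sided
  neighbourhood of \<open>0\<close> (\<open>powser_unique_at_right\<close>).

  The \<open>m\<^sub>n\<close> are strictly positive because \<open>X\<close> lives on the positive half-line, where the weight
  \<open>e\<^sup>-\<^sup>x x\<^sup>n\<close> vanishes nowhere (\<open>damped_moment_pos\<close>). Finally \<open>Q\<^sup>(\<^sup>n\<^sup>)(0) = n! p\<^sub>n = m\<^sub>n\<close> by
  differentiating the power series (\<open>higher_deriv_powser_at_0\<close>), so no denominator below is zero
  and all forms of \<open>g(n)\<close> are the same quotient \<open>m\<^sub>n\<^sub>+\<^sub>1 / m\<^sub>n\<close>.
\<close>

section \<open>Power series\<close>

text \<open>
  The difference of the two series converges on a full disc by Abel's lemma but is only known to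
  vanish on one side of \<open>0\<close>. That already makes \<open>0\<close> a non-isolated zero, which a nonzero power
  series cannot have.
\<close>
lemma powser_unique_at_right:
  fixes a b :: "nat \<Rightarrow> real"
  assumes r: "r > 0"
    and a: "\<And>w. w \<in> {0..r} \<Longrightarrow> (\<lambda>n. a n * w ^ n) sums h w"
    and b: "\<And>w. w \<in> {0..r} \<Longrightarrow> (\<lambda>n. b n * w ^ n) sums h w"
  shows "a = b"
proof -
  define c where "c n = a n - b n" for n
  have c0: "(\<lambda>n. c n * w ^ n) sums 0" if "w \<in> {0..r}" for w
    using sums_diff[OF a[OF that] b[OF that]] by (simp add: c_def algebra_simps)
  have c_sums: "(\<lambda>n. c n * w ^ n) sums (\<Sum>n. c n * w ^ n)" if "norm w < r" for w
  proof -
    have "summable (\<lambda>n. c n * r ^ n)"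
      using c0[of r] r by (auto simp: sums_iff)
    then show ?thesis
      using that r by (intro summable_sums) (rule powser_inside, auto)
  qed
  have "c 0 = 0"
    using c0[of 0] r by simp
  have "c m = 0" for m
  proof (rule ccontr)
    assume m: "c m \<noteq> 0"
    with \<open>c 0 = 0\<close> have "m > 0"
      by (metis gr0I)
    obtain s where s: "s > 0"
      "\<And>z. z \<in> cball 0 s - {0} \<Longrightarrow> (\<Sum>n. c n * z ^ n) \<noteq> 0"
      by (rule powser_0_nonzero[of r 0 c "\<lambda>w. \<Sum>n. c n * w ^ n" m])
        (use r c_sums m \<open>m > 0\<close> \<open>c 0 = 0\<close> in auto)
    have "(\<Sum>n. c n * min r s ^ n) = 0"
      using c0[of "min r s"] r s by (auto simp: sums_iff)
    with s(2)[of "min r s"] r s(1) show False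
      by (auto simp: min_def split: if_splits)
  qed
  then show ?thesis
    by (auto simp: c_def fun_eq_iff)
qed

lemma higher_deriv_powser_at_0:
  fixes c :: "nat \<Rightarrow> real"
  assumes "summable c"
  shows "(deriv ^^ n) (\<lambda>w. \<Sum>k. c k * w ^ k) 0 = fact n * c n"
proof -
  have "conv_radius c \<ge> 1"
    using conv_radius_geI[of c 1] assms by (simp add: one_ereal_def)
  then have "(0::ereal) < conv_radius c"
    by (rule less_le_trans[rotated]) simp
  then have *: "(\<lambda>w. \<Sum>k. c k * w ^ k) has_fps_expansion Abs_fps c"
    by (simp add: has_fps_expansion_def fps_conv_radius_def eval_fps_def)
  have "(deriv ^^ n) (\<lambda>w. \<Sum>k. c k * w ^ k) has_fps_expansion (fps_deriv ^^ n) (Abs_fps c)"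
    by (induction n) (auto intro: * has_fps_expansion_deriv)
  then have "(deriv ^^ n) (\<lambda>w. \<Sum>k. c k * w ^ k) 0 = eval_fps ((fps_deriv ^^ n) (Abs_fps c)) 0"
    by (auto simp: has_fps_expansion_def dest!: eventually_nhds_x_imp_x)
  then show ?thesis
    by (simp add: eval_fps_at_0 fps_0th_higher_deriv)
qed

section \<open>Exponentially damped moments\<close>

definition damped_moment :: "(real \<Rightarrow> real) \<Rightarrow> nat \<Rightarrow> real" where
  "damped_moment f n = (LBINT x:{0..}. exp (- x) * x ^ n * f x)"

lemma exp_partial_sum_le:
  fixes x :: real
  assumes "x \<ge> 0"
  shows "(\<Sum>n<k. x ^ n / fact n) \<le> exp x"
proof -
  have "(\<lambda>n. x ^ n / fact n) sums exp x"
    using exp_converges[of x] by (simp add: field_simps)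
  then show ?thesis
    using sum_le_suminf[of "\<lambda>n. x ^ n / fact n" "{..<k}"] assms by (auto simp: sums_iff)
qed

lemma set_integrable_damped_moment:
  fixes f :: "real \<Rightarrow> real"
  assumes f: "set_integrable lborel {0..} f"
  shows "set_integrable lborel {0..} (\<lambda>x. exp (- x) * x ^ n * f x)"
proof -
  have meas: "(\<lambda>x. indicator {0..} x *\<^sub>R f x) \<in> borel_measurable borel"
    using f by (auto simp: set_integrable_def)
  \<comment> \<open>One term of the exponential series is at most the whole, so \<open>e\<^sup>-\<^sup>x x\<^sup>n \<le> n!\<close>.\<close>
  have bound: "exp (- x) * x ^ n \<le> fact n" if "x \<ge> 0" for x :: real
  proof -
    have "x ^ n / fact n \<le> (\<Sum>k<Suc n. x ^ k / fact k)"
      using that by (auto intro!: sum_nonneg)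
    also have "\<dots> \<le> exp x"
      by (rule exp_partial_sum_le[OF that])
    finally show ?thesis
      by (simp add: exp_minus field_simps)
  qed
  have "integrable lborel (\<lambda>x. (exp (- x) * x ^ n) * (indicator {0..} x *\<^sub>R f x))"
  proof (rule Bochner_Integration.integrable_bound)
    show "integrable lborel (\<lambda>x. fact n * (indicator {0..} x *\<^sub>R f x))"
      using f unfolding set_integrable_def by (rule integrable_mult_right)
    show "(\<lambda>x. (exp (- x) * x ^ n) * (indicator {0..} x *\<^sub>R f x)) \<in> borel_measurable lborel"
      using meas by measurable
    show "AE x in lborel. norm ((exp (- x) * x ^ n) * (indicator {0..} x *\<^sub>R f x))
        \<le> norm (fact n * (indicator {0..} x *\<^sub>R f x))"
      using bound by (auto simp: abs_mult indicator_def intro!: mult_right_mono)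
  qed
  then show ?thesis
    by (simp add: set_integrable_def mult_ac)
qed

text \<open>
  The bound \<open>w \<le> 1\<close> is what makes \<open>\<bar>f\<bar>\<close> a dominating function: for \<open>x \<ge> 0\<close> the damped partial sums
  of \<open>e\<^sup>w\<^sup>x\<close> are at most \<open>e\<^sup>-\<^sup>x e\<^sup>w\<^sup>x \<le> 1\<close>, so the integral and the limit of the partial sums commute.
\<close>
lemma damped_moments_sums_laplace_transform:
  assumes f: "set_integrable lborel {0..} f" and w: "w \<in> {0..1}"
  shows "(\<lambda>n. damped_moment f n / fact n * w ^ n) sums laplace_transform f (1 - w)"
proof -
  define F where "F x = indicator {0..} x *\<^sub>R f x" for x
  define u where "u k x = (\<Sum>n<k. (w * x) ^ n / fact n) * exp (- x) * F x" for k x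
  have F_int: "integrable lborel F"
    using f by (simp add: F_def[abs_def] set_integrable_def)
  then have F_meas [measurable]: "F \<in> borel_measurable borel"
    by auto
  have "(\<lambda>k. integral\<^sup>L lborel (u k)) \<longlonglongrightarrow> (\<integral>x. exp (w * x) * exp (- x) * F x \<partial>lborel)"
  proof (rule integral_dominated_convergence[where w = "\<lambda>x. norm (F x)"])
    show "integrable lborel (\<lambda>x. norm (F x))"
      using F_int by simp
    show "u k \<in> borel_measurable lborel" for k
      unfolding u_def by measurable
    show "(\<lambda>x. exp (w * x) * exp (- x) * F x) \<in> borel_measurable lborel"
      by measurable
    show "AE x in lborel. (\<lambda>k. u k x) \<longlonglongrightarrow> exp (w * x) * exp (- x) * F x"
    proof (rule AE_I2)
      fix x
      have "(\<lambda>n. (w * x) ^ n / fact n) sums exp (w * x)"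
        using exp_converges[of "w * x"] by (simp add: field_simps)
      then show "(\<lambda>k. u k x) \<longlonglongrightarrow> exp (w * x) * exp (- x) * F x"
        unfolding u_def sums_def by (intro tendsto_mult tendsto_const)
    qed
    show "AE x in lborel. norm (u k x) \<le> norm (F x)" for k
    proof (rule AE_I2)
      fix x :: real
      show "norm (u k x) \<le> norm (F x)"
      proof (cases "x \<ge> 0")
        case True
        have "(\<Sum>n<k. (w * x) ^ n / fact n) \<le> exp (w * x)"
          using w True by (intro exp_partial_sum_le) auto
        also have "\<dots> \<le> exp x"
          using w True by (simp add: mult_left_le_one_le)
        finally have "(\<Sum>n<k. (w * x) ^ n / fact n) * exp (- x) \<le> 1"
          by (simp add: exp_minus field_simps)
        moreover have "(\<Sum>n<k. (w * x) ^ n / fact n) \<ge> 0"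
          using w True by (intro sum_nonneg) auto
        ultimately show ?thesis
          by (auto simp: u_def abs_mult intro!: mult_left_le_one_le)
      qed (simp add: u_def F_def)
    qed
  qed
  moreover have "integral\<^sup>L lborel (u k) = (\<Sum>n<k. damped_moment f n / fact n * w ^ n)" for k
  proof -
    have int: "integrable lborel (\<lambda>x. exp (- x) * x ^ n * F x)" for n
      using set_integrable_damped_moment[OF f, of n]
      by (simp add: set_integrable_def F_def mult_ac)
    have "u k = (\<lambda>x. \<Sum>n<k. w ^ n / fact n * (exp (- x) * x ^ n * F x))"
      by (simp add: u_def fun_eq_iff sum_distrib_left sum_distrib_right power_mult_distrib mult_ac)
    then have "integral\<^sup>L lborel (u k)
        = (\<Sum>n<k. w ^ n / fact n * (\<integral>x. exp (- x) * x ^ n * F x \<partial>lborel))"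
      using int by simp
    then show ?thesis
      by (simp add: damped_moment_def set_lebesgue_integral_def F_def mult_ac)
  qed
  moreover have "(\<integral>x. exp (w * x) * exp (- x) * F x \<partial>lborel) = laplace_transform f (1 - w)"
    unfolding laplace_transform_def set_lebesgue_integral_def F_def
    by (intro Bochner_Integration.integral_cong) (auto simp flip: exp_add simp: algebra_simps)
  ultimately show ?thesis
    by (simp add: sums_def)
qed

text \<open>
  On the half-line \<open>e\<^sup>-\<^sup>x x\<^sup>n\<close> vanishes at most at the single point \<open>0\<close>, so a zero moment would force
  \<open>f\<close> to be zero almost everywhere there.
\<close>
lemma damped_moment_pos:
  assumes f: "set_integrable lborel {0..} f" and nonneg: "\<And>x. f x \<ge> 0"
    and pos: "(LBINT x:{0..}. f x) > 0"
  shows "damped_moment f n > 0"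
proof -
  let ?h = "\<lambda>x. indicator {0..} x *\<^sub>R (exp (- x) * x ^ n * f x)"
  have int: "integrable lborel ?h"
    using set_integrable_damped_moment[OF f] by (simp add: set_integrable_def)
  have h: "?h x \<ge> 0" for x
    using nonneg by (simp add: indicator_def)
  have "integral\<^sup>L lborel ?h \<noteq> 0"
  proof
    assume "integral\<^sup>L lborel ?h = 0"
    with int h have "AE x in lborel. ?h x = 0"
      by (simp add: integral_nonneg_eq_0_iff_AE)
    moreover have "AE x in lborel. x \<noteq> (0::real)"
      by (rule AE_lborel_singleton)
    ultimately have "AE x in lborel. indicator {0..} x *\<^sub>R f x = 0"
      by eventually_elim (auto simp: indicator_def split: if_splits)
    then have "(\<integral>x. indicator {0..} x *\<^sub>R f x \<partial>lborel) = 0"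
      by (rule integral_eq_zero_AE)
    with pos show False
      by (simp add: set_lebesgue_integral_def)
  qed
  moreover have "integral\<^sup>L lborel ?h \<ge> 0"
    using h by (rule Bochner_Integration.integral_nonneg)
  ultimately show ?thesis
    by (simp add: damped_moment_def set_lebesgue_integral_def)
qed

section \<open>Densities and mass functions\<close>

lemma density_of_positive_variable:
  fixes X :: "'b \<Rightarrow> real"
  assumes L: "prob_space L" and X: "AE \<omega> in L. X \<omega> > 0"
    and nonneg: "\<And>x. f x \<ge> 0"
    and dist: "distributed L lborel X (\<lambda>x. ennreal (f x))"
  shows "set_integrable lborel {0..} f" "(LBINT x:{0..}. f x) = 1"
proof -
  interpret prob_space L by fact
  have X_meas: "X \<in> borel_measurable L"
    using distributed_measurable[OF dist] by simp
  have "integrable lborel (\<lambda>x. f x * 1)"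
    by (subst distributed_integrable[OF dist]) (use nonneg in auto)
  then have "integrable lborel f"
    by simp
  then show "set_integrable lborel {0..} f"
    unfolding set_integrable_def by (rule integrable_mult_indicator[rotated]) simp
  have "(\<integral>x. f x * indicator {0..} x \<partial>lborel) = (\<integral>\<omega>. indicator {0..} (X \<omega>) \<partial>L)"
    by (rule distributed_integral[OF dist]) (use nonneg in auto)
  also have "\<dots> = (\<integral>\<omega>. 1 \<partial>L)"
    by (rule integral_cong_AE) (use X X_meas in auto)
  finally show "(LBINT x:{0..}. f x) = 1"
    by (simp add: set_lebesgue_integral_def mult_ac prob_space)
qed

lemma summable_prob_mass:
  assumes M: "prob_space M" and N: "N \<in> M \<rightarrow>\<^sub>M count_space UNIV"
  shows "summable (prob_mass M N)"
proof -
  interpret prob_space M by fact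
  have "(\<lambda>n. prob {\<omega> \<in> space M. N \<omega> = n}) sums prob (\<Union>n. {\<omega> \<in> space M. N \<omega> = n})"
    by (rule finite_measure_UNION) (use N in \<open>auto simp: disjoint_family_on_def\<close>)
  then show ?thesis
    by (simp add: prob_mass_def[abs_def] sums_iff)
qed

text \<open>
  The right-hand side is \<open>\<integral>\<^sub>0\<^sup>\<infinity> (e\<^sup>-\<^sup>x x\<^sup>n / n!) f(x) dx\<close>: if \<open>f\<close> is a density, \<open>N\<close> has the mixed Poisson
  distribution with rate density \<open>f\<close>.
\<close>
lemma prob_mass_eq_damped_moment:
  assumes p: "summable (prob_mass M N)" and f: "set_integrable lborel {0..} f"
    and Q: "\<And>w. w \<in> {0..1} \<Longrightarrow> prob_gen_fun M N w = laplace_transform f (1 - w)"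
  shows "prob_mass M N n = damped_moment f n / fact n"
proof -
  have "prob_mass M N = (\<lambda>n. damped_moment f n / fact n)"
  proof (rule powser_unique_at_right[of 1 _ "\<lambda>w. laplace_transform f (1 - w)"])
    fix w :: real
    assume w: "w \<in> {0..1}"
    have "summable (\<lambda>n. prob_mass M N n * w ^ n)"
    proof (rule summable_comparison_test'[OF p])
      show "norm (prob_mass M N n * w ^ n) \<le> prob_mass M N n" for n
        using w power_le_one[of w n]
        by (auto simp: prob_mass_def abs_mult intro!: mult_left_le)
    qed
    then show "(\<lambda>n. prob_mass M N n * w ^ n) sums laplace_transform f (1 - w)"
      using Q[OF w] by (simp add: prob_gen_fun_def sums_iff)
    show "(\<lambda>n. damped_moment f n / fact n * w ^ n) sums laplace_transform f (1 - w)"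
      by (rule damped_moments_sums_laplace_transform[OF f w])
  qed simp
  then show ?thesis
    by simp
qed

section \<open>The recurrence\<close>

theorem corollary1:
  fixes M :: "'a measure" and N :: "'a \<Rightarrow> nat"
    and L :: "'b measure" and X :: "'b \<Rightarrow> real" and f :: "real \<Rightarrow> real"
  defines "p \<equiv> prob_mass M N"
    and "Q \<equiv> prob_gen_fun M N"
    and "\<phi> \<equiv> laplace_transform f"
    and "g \<equiv> recurrence_ratio (prob_gen_fun M N)"
  assumes "prob_space M"
    and "N \<in> M \<rightarrow>\<^sub>M count_space UNIV"
    and "prob_space L"
    and "AE \<omega> in L. X \<omega> > 0"
    and "\<And>x. f x \<ge> 0"
    and "distributed L lborel X (\<lambda>x. ennreal (f x))"
    and "\<And>w. w \<in> {0..1} \<Longrightarrow> Q w = \<phi> (1 - w)"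
  shows "\<forall>n.
      p n = nth_deriv_at_0 Q n / fact n \<and>
      p n > 0 \<and>
      nth_deriv_at_0 Q n > 0 \<and>
      (LBINT x:{0..}. exp (- x) * x ^ n * f x) > 0 \<and>
      p (n + 1) = p n / real (n + 1) * g n \<and>
      g n = nth_deriv_at_0 Q (n + 1) / nth_deriv_at_0 Q n \<and>
      g n = real (n + 1) * p (n + 1) / p n \<and>
      g n = (LBINT x:{0..}. exp (- x) * x ^ (n + 1) * f x)
          / (LBINT x:{0..}. exp (- x) * x ^ n * f x)"
proof -
  note f = density_of_positive_variable[OF assms(7-10)]
  note summ = summable_prob_mass[OF assms(5,6)]
  have p: "p n = damped_moment f n / fact n" for n
    unfolding p_def using prob_mass_eq_damped_moment[OF summ f(1)] assms(11)
    by (simp add: Q_def \<phi>_def)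
  have pos: "damped_moment f n > 0" for n
    by (rule damped_moment_pos) (use f assms(9) in auto)
  have D: "nth_deriv_at_0 Q n = damped_moment f n" for n
    using higher_deriv_powser_at_0[OF summ, of n] p[of n]
    by (simp add: nth_deriv_at_0_def Q_def prob_gen_fun_def[abs_def] p_def)
  have g: "g n = damped_moment f (n + 1) / damped_moment f n" for n
    using D unfolding g_def recurrence_ratio_def Q_def by simp
  have "(LBINT x:{0..}. exp (- x) * x ^ n * f x) = damped_moment f n" for n
    by (simp add: damped_moment_def)
  moreover have "damped_moment f n \<noteq> 0" for n
    using pos[of n] by simp
  ultimately show ?thesis
    using pos by (simp add: p D g del: power_Suc)
qed

end
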